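(* Let $n\ge1$. The sum of the lengths of the orbits of $1$ over all elements $\alpha\in\mathcal{IS}_n$ equals the total number of chains in the chain decompositions of all elements of $\mathcal{IS}_n$.
   Context: Let $N=\{1,2,\dots,n\}$. $\mathcal{IS}_n$ is the symmetric inverse semigroup, i.e. the set of all partial injective maps $\alpha$ from $N$ to $N$ (bijections from a subset $\operatorname{dom}(\alpha)\subseteq N$ onto a subset $\operatorname{im}(\alpha)\subseteq N$; the empty map is allowed). The graph of the action of $\alpha$ is the directed graph on $N$ with an arrow $x\to\alpha(x)$ for each $x\in\operatorname{dom}(\alpha)$. Each connected component is either a directed cycle (a fixed point is a cycle of length 1) or a directed path $a_1\to\dots\to a_k$, $k\ge1$, with $a_1\notin\operatorname{im}(\alpha)$ and $a_k\notin\operatorname{dom}(\alpha)$ (a "chain" of $\alpha$; a chain of length 1 is a point $x\notin\operatorname{dom}(\alpha)\cup\operatorname{im}(\alpha)$). This is the chain decomposition of $\alpha$. If $x\in\operatorname{dom}(\alpha)$, the orbit of $x$ under $\alpha$ is the set $\{x,\alpha(x),\alpha^2(x),\dots\}$ (of those iterates that are defined), and its length is its cardinality. If $x\notin\operatorname{dom}(\alpha)$, the orbit of $x$ is by convention empty and has length $0$. *)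

theory Defs
  imports Main
begin

definition sym_inv_semigroup :: "nat \<Rightarrow> (nat \<rightharpoonup> nat) set" where
  "sym_inv_semigroup n =
     {\<alpha>. dom \<alpha> \<subseteq> {1..n} \<and> ran \<alpha> \<subseteq> {1..n} \<and> inj_on \<alpha> (dom \<alpha>)}"

definition arrow :: "(nat \<rightharpoonup> nat) \<Rightarrow> nat \<Rightarrow> nat \<Rightarrow> bool" where
  "arrow \<alpha> x y \<longleftrightarrow> \<alpha> x = Some y"

text \<open>
  Connected components are taken in the undirected sense, since \<^const>\<open>equivclp\<close> is the
  equivalence closure; they are represented by their vertex sets.
\<close>

definition graph_components :: "nat \<Rightarrow> (nat \<rightharpoonup> nat) \<Rightarrow> nat set set" where
  "graph_components n \<alpha> =
     {1..n} // {(x, y). x \<in> {1..n} \<and> y \<in> {1..n} \<and> equivclp (arrow \<alpha>) x y}"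

definition is_chain_path :: "(nat \<rightharpoonup> nat) \<Rightarrow> nat list \<Rightarrow> bool" where
  "is_chain_path \<alpha> as \<longleftrightarrow>
     as \<noteq> [] \<and> distinct as \<and> successively (arrow \<alpha>) as \<and>
     hd as \<notin> ran \<alpha> \<and> last as \<notin> dom \<alpha>"

definition chain_components :: "nat \<Rightarrow> (nat \<rightharpoonup> nat) \<Rightarrow> nat set set" where
  "chain_components n \<alpha> = {C \<in> graph_components n \<alpha>. \<exists>as. is_chain_path \<alpha> as \<and> set as = C}"

definition partial_iterate :: "(nat \<rightharpoonup> nat) \<Rightarrow> nat \<Rightarrow> (nat \<rightharpoonup> nat)" where
  "partial_iterate \<alpha> k x = ((\<lambda>v. Option.bind v \<alpha>) ^^ k) (Some x)"

definition partial_orbit :: "(nat \<rightharpoonup> nat) \<Rightarrow> nat \<Rightarrow> nat set" where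
  "partial_orbit \<alpha> x =
     (if x \<in> dom \<alpha> then {y. \<exists>k. partial_iterate \<alpha> k x = Some y} else {})"

text \<open>
  The following finiteness facts ensure that summing over the semigroup and counting chains
  or orbit points never returns the
  default value \<open>0\<close> for infinite sets.
\<close>

lemma finite_sym_inv_semigroup: "finite (sym_inv_semigroup n)"
proof -
  have "sym_inv_semigroup n \<subseteq> (\<Union>A\<in>Pow {1..n}. {\<alpha>. dom \<alpha> = A \<and> ran \<alpha> \<subseteq> {1..n}})"
    by (auto simp: sym_inv_semigroup_def)
  moreover have "finite {\<alpha>. dom \<alpha> = A \<and> ran \<alpha> \<subseteq> {1..n}}" if "A \<in> Pow {1..n}" for A
    using that finite_subset[of A "{1..n}"] by (intro finite_set_of_finite_maps) auto
  ultimately show ?thesis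
    by (meson finite_Pow_iff finite_UN_I finite_atLeastAtMost finite_subset)
qed

lemma finite_chain_components: "finite (chain_components n \<alpha>)"
proof -
  have "chain_components n \<alpha> \<subseteq> Pow {1..n}"
    by (auto simp: chain_components_def graph_components_def quotient_def)
  then show ?thesis
    by (rule finite_subset) simp
qed

lemma finite_partial_orbit:
  assumes "\<alpha> \<in> sym_inv_semigroup n"
  shows "finite (partial_orbit \<alpha> x)"
proof -
  have "y \<in> insert x (ran \<alpha>)" if "partial_iterate \<alpha> k x = Some y" for k y
    using that by (cases k) (auto simp: partial_iterate_def bind_eq_Some_conv ran_def)
  then have "partial_orbit \<alpha> x \<subseteq> insert x (ran \<alpha>)"
    unfolding partial_orbit_def by auto
  moreover have "finite (ran \<alpha>)"
    using assms finite_subset[of "ran \<alpha>" "{1..n}"] by (auto simp: sym_inv_semigroup_def)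
  ultimately show ?thesis
    by (meson finite_insert finite_subset)
qed

end

theory Submission
  imports Defs
begin

text \<open>
  Let \<open>r a b\<close> be the number of partial injections from a set with \<open>a\<close> elements to one with \<open>b\<close>
  elements.  Both totals are equal to \<open>n * r (n - 1) n\<close>.

  A chain has exactly one point outside \<open>dom \<alpha>\<close>, namely its end, and a cycle has none.  So the
  chains of \<open>\<alpha>\<close> correspond to the points outside \<open>dom \<alpha>\<close> (\<open>card_chain_components\<close>).  For each of the
  \<open>n\<close> points \<open>x\<close>, the elements of the semigroup that are undefined at \<open>x\<close> are the partial injections
  from the other \<open>n - 1\<close> points to all \<open>n\<close> points, and there are \<open>r (n - 1) n\<close> of them.

  For the orbits, let the orbit of \<open>x\<close> contain \<open>x\<close> even if \<open>x \<notin> dom \<alpha>\<close>.  This adds one for every \<open>\<alpha>\<close>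
  undefined at \<open>x\<close>, that is \<open>r (n - 1) n\<close> in total, so it must be shown that the modified orbit
  lengths sum to \<open>(n + 1) * r (n - 1) n\<close>.  To do so, follow the first arrow \<open>x \<rightarrow> b\<close> of the orbit
  and delete it.  What is left is a partial injection that is not defined at \<open>x\<close> and does not take
  the value \<open>b\<close>, and the orbit loses just the point \<open>x\<close> and starts at \<open>b\<close> instead.  After several
  such steps the available sources are \<open>insert x C\<close>, with \<open>x\<close> the current start of the orbit, and
  the available targets are \<open>insert t C\<close>, with \<open>t\<close> the original start.  This is the form for which
  the sum is computed, by induction on \<open>card C\<close>, in \<open>sum_card_forward_orbit\<close>.  The
  resulting recursion is solved with the two recursions of \<open>r\<close>, one in each argument.
\<close>

section \<open>Partial injections between two finite sets\<close>

definition partial_injections :: "'a set \<Rightarrow> 'b set \<Rightarrow> ('a \<rightharpoonup> 'b) set" where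
  "partial_injections A B = {\<alpha>. dom \<alpha> \<subseteq> A \<and> ran \<alpha> \<subseteq> B \<and> inj_on \<alpha> (dom \<alpha>)}"

lemma partial_injections_empty: "partial_injections {} B = {Map.empty}"
  by (auto simp: partial_injections_def)

lemma partial_injections_iff:
  "\<alpha> \<in> partial_injections A B \<longleftrightarrow>
    (\<forall>x y. \<alpha> x = Some y \<longrightarrow> x \<in> A \<and> y \<in> B) \<and>
    (\<forall>x x' y. \<alpha> x = Some y \<longrightarrow> \<alpha> x' = Some y \<longrightarrow> x = x')"
  unfolding partial_injections_def inj_on_def by (auto simp: dom_def ran_def)

lemma partial_injection_upd:
  assumes "\<alpha> \<in> partial_injections A (B - {b})" "b \<in> B"
  shows "\<alpha>(x \<mapsto> b) \<in> partial_injections (insert x A) B"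
proof -
  have *: "\<And>x y. \<alpha> x = Some y \<Longrightarrow> x \<in> A \<and> y \<in> B \<and> y \<noteq> b"
    and inj: "\<And>x x' y. \<alpha> x = Some y \<Longrightarrow> \<alpha> x' = Some y \<Longrightarrow> x = x'"
    using assms(1) unfolding partial_injections_iff by blast+
  show ?thesis
    unfolding partial_injections_iff by (auto simp: assms(2) dest: * intro: inj split: if_splits)
qed

lemma partial_injection_restrict:
  assumes "\<alpha> \<in> partial_injections (insert x A) B" "\<alpha> x = Some b"
  shows "\<alpha>(x := None) \<in> partial_injections A (B - {b})"
proof -
  have *: "\<And>x' y. \<alpha> x' = Some y \<Longrightarrow> x' \<in> insert x A \<and> y \<in> B"
    and inj: "\<And>x x' y. \<alpha> x = Some y \<Longrightarrow> \<alpha> x' = Some y \<Longrightarrow> x = x'"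
    using assms(1) unfolding partial_injections_iff by blast+
  show ?thesis
    unfolding partial_injections_iff
    using * inj assms(2) by (simp split: if_splits) blast
qed

lemma partial_injections_insert:
  assumes "x \<notin> A"
  shows "partial_injections (insert x A) B =
    partial_injections A B \<union> (\<Union>b\<in>B. (\<lambda>\<alpha>. \<alpha>(x \<mapsto> b)) ` partial_injections A (B - {b}))"
    (is "?L = ?R")
proof
  show "?L \<subseteq> ?R"
  proof
    fix \<alpha> assume \<alpha>: "\<alpha> \<in> ?L"
    show "\<alpha> \<in> ?R"
    proof (cases "\<alpha> x")
      case None
      then have "\<alpha> \<in> partial_injections A B"
        using \<alpha> by (auto simp: partial_injections_def dom_def)
      then show ?thesis by blast
    next
      case (Some b)
      then have "b \<in> B" using \<alpha> by (auto simp: partial_injections_def ran_def)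
      moreover have "\<alpha> = (\<alpha>(x := None))(x \<mapsto> b)" using Some by auto
      ultimately show ?thesis
        using partial_injection_restrict[OF \<alpha> Some] by (intro UnI2 UN_I image_eqI)
    qed
  qed
next
  have "partial_injections A B \<subseteq> ?L" by (auto simp: partial_injections_def)
  moreover have "(\<lambda>\<alpha>. \<alpha>(x \<mapsto> b)) ` partial_injections A (B - {b}) \<subseteq> ?L" if "b \<in> B" for b
    using that by (auto intro: partial_injection_upd)
  ultimately show "?R \<subseteq> ?L" by (intro Un_least UN_least)
qed

lemma finite_partial_injections:
  assumes "finite A" "finite B"
  shows "finite (partial_injections A B)"
  using assms
proof (induction A arbitrary: B rule: finite_induct)
  case empty
  then show ?case by (simp add: partial_injections_empty)
next
  case (insert x A)
  then show ?case by (simp add: partial_injections_insert)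
qed

text \<open>
  Case distinction on the value at a new source \<open>x\<close>, under a sum.  It yields both the recursion for
  the number of partial injections and the one for the orbit lengths.
\<close>

lemma sum_partial_injections_insert:
  fixes g :: "('a \<rightharpoonup> 'b) \<Rightarrow> nat"
  assumes "finite A" "finite B" "x \<notin> A"
  shows "(\<Sum>\<alpha>\<in>partial_injections (insert x A) B. g \<alpha>) =
    (\<Sum>\<alpha>\<in>partial_injections A B. g \<alpha>) +
    (\<Sum>b\<in>B. \<Sum>\<alpha>\<in>partial_injections A (B - {b}). g (\<alpha>(x \<mapsto> b)))"
proof -
  let ?U = "\<lambda>b. (\<lambda>\<alpha>. \<alpha>(x \<mapsto> b)) ` partial_injections A (B - {b})"
  have x: "\<alpha> x = None" if "\<alpha> \<in> partial_injections A B'" for \<alpha> :: "'a \<rightharpoonup> 'b" and B'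
    using that assms(3) by (auto simp: partial_injections_def)
  have fin: "finite (?U b)" for b
    using assms by (simp add: finite_partial_injections)
  have inj: "inj_on (\<lambda>\<alpha>. \<alpha>(x \<mapsto> b)) (partial_injections A (B - {b}))" for b
  proof (rule inj_onI)
    fix \<alpha> \<beta> assume *: "\<alpha> \<in> partial_injections A (B - {b})" "\<beta> \<in> partial_injections A (B - {b})"
      "\<alpha>(x \<mapsto> b) = \<beta>(x \<mapsto> b)"
    then have "(\<alpha>(x \<mapsto> b))(x := None) = (\<beta>(x \<mapsto> b))(x := None)" by simp
    then show "\<alpha> = \<beta>" using x[OF *(1)] x[OF *(2)] by (simp add: fun_upd_idem)
  qed
  have "partial_injections A B \<inter> (\<Union>b\<in>B. ?U b) = {}"
    using x by fastforce
  then have "(\<Sum>\<alpha>\<in>partial_injections (insert x A) B. g \<alpha>) =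
      (\<Sum>\<alpha>\<in>partial_injections A B. g \<alpha>) + (\<Sum>\<alpha>\<in>(\<Union>b\<in>B. ?U b). g \<alpha>)"
    unfolding partial_injections_insert[OF assms(3)]
    using assms fin by (intro sum.union_disjoint) (auto simp: finite_partial_injections)
  also have "(\<Sum>\<alpha>\<in>(\<Union>b\<in>B. ?U b). g \<alpha>) = (\<Sum>b\<in>B. \<Sum>\<alpha>\<in>?U b. g \<alpha>)"
  proof (rule sum.UNION_disjoint)
    show "\<forall>b\<in>B. \<forall>c\<in>B. b \<noteq> c \<longrightarrow> ?U b \<inter> ?U c = {}"
      by (auto dest!: fun_cong[where x = x])
  qed (use assms fin in auto)
  also have "\<dots> = (\<Sum>b\<in>B. \<Sum>\<alpha>\<in>partial_injections A (B - {b}). g (\<alpha>(x \<mapsto> b)))"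
    by (simp add: sum.reindex[OF inj])
  finally show ?thesis .
qed

fun num_partial_injections :: "nat \<Rightarrow> nat \<Rightarrow> nat" where
  "num_partial_injections 0 b = 1"
| "num_partial_injections (Suc a) b =
     num_partial_injections a b + b * num_partial_injections a (b - 1)"

lemma card_partial_injections:
  assumes "finite A" "finite B"
  shows "card (partial_injections A B) = num_partial_injections (card A) (card B)"
  using assms
proof (induction A arbitrary: B rule: finite_induct)
  case empty
  then show ?case by (simp add: partial_injections_empty)
next
  case (insert x A)
  have "card (partial_injections (insert x A) B) =
      card (partial_injections A B) + (\<Sum>b\<in>B. card (partial_injections A (B - {b})))"
    using sum_partial_injections_insert[OF insert.hyps(1) insert.prems insert.hyps(2),
        of "\<lambda>_. 1"] by simp
  then show ?case using insert by simp
qed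

text \<open>
  Inverting partial injections exchanges the two arguments, so the defining recursion has a mirror
  image.  It is derived here by arithmetic alone.
\<close>

lemma num_partial_injections_Suc_right:
  "num_partial_injections a (Suc b) =
     num_partial_injections a b + a * num_partial_injections (a - 1) b"
proof (induction a arbitrary: b)
  case 0
  then show ?case by simp
next
  case (Suc a)
  have 1: "b * num_partial_injections a b =
     b * num_partial_injections a (b - 1) + b * a * num_partial_injections (a - 1) (b - 1)"
    using Suc.IH[of "b - 1"] by (cases b) (simp_all add: algebra_simps)
  have 2: "a * num_partial_injections a b =
     a * num_partial_injections (a - 1) b + a * b * num_partial_injections (a - 1) (b - 1)"
    by (cases a) (simp_all add: algebra_simps)
  show ?case using Suc.IH[of b] 1 2 by (simp add: algebra_simps)
qed

section \<open>Orbits\<close>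

text \<open>
  Unlike \<^const>\<open>partial_orbit\<close>, this always contains the starting point, which makes it
  compatible with the removal of the first arrow.
\<close>

definition forward_orbit :: "(nat \<rightharpoonup> nat) \<Rightarrow> nat \<Rightarrow> nat set" where
  "forward_orbit \<alpha> x = {y. (arrow \<alpha>)\<^sup>*\<^sup>* x y}"

lemma partial_iterate_eq_Some_iff: "partial_iterate \<alpha> k x = Some y \<longleftrightarrow> (arrow \<alpha> ^^ k) x y"
  by (induction k arbitrary: y)
    (auto simp: partial_iterate_def bind_eq_Some_conv arrow_def relcompp_apply)

lemma partial_orbit_eq:
  "partial_orbit \<alpha> x = (if x \<in> dom \<alpha> then forward_orbit \<alpha> x else {})"
  by (simp add: partial_orbit_def forward_orbit_def partial_iterate_eq_Some_iff rtranclp_power)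

lemma forward_orbit_undefined:
  assumes "\<alpha> x = None"
  shows "forward_orbit \<alpha> x = {x}"
  using assms by (auto simp: forward_orbit_def arrow_def elim: converse_rtranclpE)

lemma forward_orbit_subset: "forward_orbit \<alpha> x \<subseteq> insert x (ran \<alpha>)"
proof
  fix y assume "y \<in> forward_orbit \<alpha> x"
  then have "(arrow \<alpha>)\<^sup>*\<^sup>* x y" by (simp add: forward_orbit_def)
  then show "y \<in> insert x (ran \<alpha>)"
    by (cases rule: rtranclp.cases) (auto simp: arrow_def ran_def)
qed

text \<open>
  Removing the first arrow of an orbit.  This also holds when that arrow lies on a cycle: if the
  orbit of \<open>b\<close> under \<open>\<beta>\<close> runs into \<open>x\<close>, it stops there, whereas under the extended map it
  continues with \<open>b\<close>, which only repeats points already visited.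
\<close>

lemma forward_orbit_upd:
  assumes "\<beta> x = None"
  shows "forward_orbit (\<beta>(x \<mapsto> b)) x = insert x (forward_orbit \<beta> b)"
proof
  have "y \<in> insert x (forward_orbit \<beta> b)" if "(arrow (\<beta>(x \<mapsto> b)))\<^sup>*\<^sup>* x y" for y
    using that
    by (induction) (auto simp: forward_orbit_def arrow_def split: if_splits
        intro: rtranclp.rtrancl_into_rtrancl)
  then show "forward_orbit (\<beta>(x \<mapsto> b)) x \<subseteq> insert x (forward_orbit \<beta> b)"
    by (auto simp: forward_orbit_def)
next
  have "arrow \<beta> \<le> arrow (\<beta>(x \<mapsto> b))"
    using assms by (auto simp: arrow_def)
  then have "(arrow \<beta>)\<^sup>*\<^sup>* \<le> (arrow (\<beta>(x \<mapsto> b)))\<^sup>*\<^sup>*" by (rule rtranclp_mono)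
  moreover have "arrow (\<beta>(x \<mapsto> b)) x b" by (simp add: arrow_def)
  ultimately show "insert x (forward_orbit \<beta> b) \<subseteq> forward_orbit (\<beta>(x \<mapsto> b)) x"
    by (auto simp: forward_orbit_def intro: converse_rtranclp_into_rtranclp)
qed

text \<open>
  Intersecting with the sources \<open>insert x C\<close> leaves out the target \<open>t\<close>, except when \<open>t = x\<close>.  Before
  any arrow is removed, the orbit starts at \<open>t\<close>, so a return to \<open>t\<close> closes a cycle and must not be
  counted a second time.  The first arrow from \<open>x\<close> may be missing, lead to \<open>t\<close>, where the orbit
  ends because \<open>t \<notin> C\<close>, or lead to some \<open>b \<in> C\<close>.  In the last case the situation is the same with
  \<open>C - {b}\<close> in place of \<open>C\<close>, start \<open>b\<close> and unchanged \<open>t\<close>.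
\<close>

lemma sum_card_forward_orbit:
  assumes "finite C" "x \<notin> C" "t \<notin> C"
  shows "(\<Sum>\<alpha>\<in>partial_injections (insert x C) (insert t C).
            card (forward_orbit \<alpha> x \<inter> insert x C)) =
         (card C + 2) * num_partial_injections (card C) (Suc (card C))"
  using assms
proof (induction "card C" arbitrary: C x)
  case (0 C x)
  then have C: "C = {}" by simp
  have "forward_orbit \<alpha> x \<inter> {x} = {x}" for \<alpha>
    by (auto simp: forward_orbit_def)
  then show ?case
    using card_partial_injections[of "{x}" "{t}"] by (simp add: C)
next
  case (Suc c C x)
  let ?r = num_partial_injections
  let ?PI = "partial_injections :: nat set \<Rightarrow> nat set \<Rightarrow> _"
  have fresh: "\<alpha> y = None" if "\<alpha> \<in> ?PI C B" "y \<notin> C" for \<alpha> B y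
    using that by (auto simp: partial_injections_def)
  have card_upd: "card (forward_orbit (\<alpha>(x \<mapsto> b)) x \<inter> insert x C) =
      Suc (card (forward_orbit \<alpha> b \<inter> C))" if "\<alpha> \<in> ?PI C B" for \<alpha> B b
    using fresh[OF that Suc.prems(2)] Suc.prems(1,2)
    by (simp add: forward_orbit_upd)
  have undefined: "(\<Sum>\<alpha>\<in>?PI C (insert t C). card (forward_orbit \<alpha> x \<inter> insert x C)) =
      ?r (Suc c) (Suc (Suc c))"
  proof -
    have "(\<Sum>\<alpha>\<in>?PI C (insert t C). card (forward_orbit \<alpha> x \<inter> insert x C)) =
        (\<Sum>\<alpha>\<in>?PI C (insert t C). 1)"
      by (intro sum.cong) (auto simp: forward_orbit_undefined fresh Suc.prems)
    then show ?thesis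
      using Suc.prems Suc.hyps(2) card_partial_injections[of C "insert t C"] by simp
  qed
  have leave: "(\<Sum>\<alpha>\<in>?PI C (C).
      card (forward_orbit (\<alpha>(x \<mapsto> t)) x \<inter> insert x C)) = ?r (Suc c) (Suc c)"
  proof -
    have "(\<Sum>\<alpha>\<in>?PI C (C). card (forward_orbit (\<alpha>(x \<mapsto> t)) x \<inter> insert x C)) =
        (\<Sum>\<alpha>\<in>?PI C (C). 1)"
      by (intro sum.cong refl)
        (simp add: card_upd forward_orbit_undefined fresh Suc.prems)
    then show ?thesis
      using Suc.prems Suc.hyps(2) card_partial_injections[of C C] by simp
  qed
  have stay: "(\<Sum>\<alpha>\<in>?PI C (insert t C - {b}).
      card (forward_orbit (\<alpha>(x \<mapsto> b)) x \<inter> insert x C)) =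
      ?r (Suc c) (Suc c) + (c + 2) * ?r c (Suc c)" if b: "b \<in> C" for b
  proof -
    let ?C = "C - {b}"
    have eqs: "insert b ?C = C" "insert t C - {b} = insert t ?C"
      using b Suc.prems by auto
    have c: "card ?C = c" using b Suc.hyps(2) Suc.prems by simp
    have "(\<Sum>\<alpha>\<in>?PI C (insert t C - {b}). card (forward_orbit (\<alpha>(x \<mapsto> b)) x \<inter> insert x C)) =
        (\<Sum>\<alpha>\<in>?PI C (insert t C - {b}). Suc (card (forward_orbit \<alpha> b \<inter> C)))"
      by (intro sum.cong refl card_upd)
    also have "\<dots> = card (?PI C (insert t ?C)) +
        (\<Sum>\<alpha>\<in>?PI C (insert t ?C). card (forward_orbit \<alpha> b \<inter> C))"
      by (simp only: eqs(2) sum_Suc)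
    also have "card (?PI C (insert t ?C)) = ?r (Suc c) (Suc c)"
      using card_partial_injections[of C "insert t ?C"] Suc.prems Suc.hyps(2) c by simp
    also have "(\<Sum>\<alpha>\<in>?PI C (insert t ?C). card (forward_orbit \<alpha> b \<inter> C)) = (c + 2) * ?r c (Suc c)"
      using Suc.hyps(1)[of ?C b] Suc.prems unfolding eqs(1) c by simp
    finally show ?thesis .
  qed
  have "(\<Sum>\<alpha>\<in>?PI (insert x C) (insert t C). card (forward_orbit \<alpha> x \<inter> insert x C)) =
      ?r (Suc c) (Suc (Suc c)) + (?r (Suc c) (Suc c) +
        Suc c * (?r (Suc c) (Suc c) + (c + 2) * ?r c (Suc c)))"
    using Suc.prems(1,3) Suc.hyps(2)
    by (subst sum_partial_injections_insert)
      (simp_all add: Suc.prems undefined leave stay del: num_partial_injections.simps)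
  also have "\<dots> = (Suc c + 2) * ?r (Suc c) (Suc (Suc c))"
    unfolding num_partial_injections_Suc_right[of "Suc c" "Suc c"]
    by (simp add: algebra_simps del: num_partial_injections.simps)
  finally show ?case using Suc.hyps(2) by simp
qed

section \<open>Chains and their ends\<close>

text \<open>
  The points that reach \<open>x\<close> are closed under following arrows backwards, and also forwards because
  no arrow leaves \<open>x\<close>.  So they form the whole component of \<open>x\<close>.
\<close>

lemma equivclp_chain_end:
  assumes "equivclp (arrow \<alpha>) x y" "\<alpha> x = None"
  shows "(arrow \<alpha>)\<^sup>*\<^sup>* y x"
  using assms(1)
proof (induction rule: equivclp_induct)
  case base
  then show ?case by simp
next
  case (step y z)
  show ?case
  proof (cases "arrow \<alpha> z y")
    case True
    then show ?thesis using step.IH by (rule converse_rtranclp_into_rtranclp)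
  next
    case False
    then have yz: "\<alpha> y = Some z" using step.hyps by (auto simp: arrow_def)
    show ?thesis using step.IH
      by (cases rule: converse_rtranclpE) (use yz assms(2) in \<open>auto simp: arrow_def\<close>)
  qed
qed

lemma successively_nth:
  assumes "successively P xs" "Suc i < length xs"
  shows "P (xs ! i) (xs ! Suc i)"
  using assms by (simp add: successively_conv_nth)

text \<open>
  A longest path without repetitions that ends in \<open>x\<close> starts outside \<open>ran \<alpha>\<close>.  Otherwise it could be
  prolonged by a preimage \<open>u\<close> of its first point: \<open>u\<close> is not on the path, since the image of any
  point of the path is a later point or, for \<open>x\<close>, undefined.
\<close>

lemma ex_chain_path:
  assumes "x \<in> {1..n}" "\<alpha> x = None" and \<alpha>: "\<alpha> \<in> sym_inv_semigroup n"
  obtains as where "is_chain_path \<alpha> as" "last as = x" "set as \<subseteq> {1..n}"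
proof -
  define P where "P as \<longleftrightarrow> as \<noteq> [] \<and> distinct as \<and> successively (arrow \<alpha>) as \<and> last as = x \<and>
    set as \<subseteq> {1..n}" for as
  have single: "P [x]" using assms by (simp add: P_def)
  have bound: "length as \<le> n" if "P as" for as
    using that card_mono[of "{1..n}" "set as"] by (auto simp: P_def distinct_card)
  have "\<exists>as. P as \<and> (\<forall>bs. P bs \<longrightarrow> length bs \<le> length as)"
    by (rule ex_has_greatest_nat[where k = "[x]" and b = "Suc n"])
      (simp_all add: single bound less_Suc_eq_le)
  then obtain as where as: "P as" and max: "\<And>bs. P bs \<Longrightarrow> length bs \<le> length as"
    by (elim exE conjE) simp
  have "hd as \<notin> ran \<alpha>"
  proof
    assume "hd as \<in> ran \<alpha>"
    then obtain u where u: "\<alpha> u = Some (hd as)" by (auto simp: ran_def)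
    have "u \<notin> set as"
    proof
      assume "u \<in> set as"
      then obtain i where i: "i < length as" "as ! i = u" by (auto simp: in_set_conv_nth)
      show False
      proof (cases "Suc i < length as")
        case True
        then have "as ! Suc i = as ! 0"
          using successively_nth[of "arrow \<alpha>" as i] as i u
          by (auto simp: P_def arrow_def hd_conv_nth)
        then show False using True as by (simp add: P_def nth_eq_iff_index_eq)
      next
        case False
        then have "i = length as - 1" using i(1) by simp
        moreover have "as \<noteq> []" using i(1) by auto
        ultimately have "u = last as" using i(2) by (simp add: last_conv_nth)
        then have "u = x" using as by (simp add: P_def)
        then show False using u assms by simp
      qed
    qed
    moreover have "u \<in> {1..n}" using \<alpha> u by (auto simp: sym_inv_semigroup_def)
    ultimately have "P (u # as)"
      using as u by (cases as) (auto simp: P_def arrow_def)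
    then show False using max by fastforce
  qed
  then have "is_chain_path \<alpha> as" using as assms(2) by (auto simp: P_def is_chain_path_def)
  with as show ?thesis by (intro that) (auto simp: P_def)
qed

lemma chain_path_reaches_last:
  assumes "successively (arrow \<alpha>) as" "y \<in> set as"
  shows "(arrow \<alpha>)\<^sup>*\<^sup>* y (last as)"
  using assms
proof (induction as arbitrary: y)
  case Nil
  then show ?case by simp
next
  case (Cons a as)
  show ?case
  proof (cases "as = []")
    case True
    then show ?thesis using Cons by simp
  next
    case False
    then have "arrow \<alpha> a (hd as)" "successively (arrow \<alpha>) as"
      using Cons.prems(1) by (simp_all add: successively_Cons)
    then have "(arrow \<alpha>)\<^sup>*\<^sup>* a (last as)"
      using Cons.IH[of "hd as"] False by (simp add: converse_rtranclp_into_rtranclp)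
    moreover have "(arrow \<alpha>)\<^sup>*\<^sup>* y (last as)" if "y \<in> set as"
      using Cons.IH[OF \<open>successively (arrow \<alpha>) as\<close> that] .
    ultimately show ?thesis using Cons.prems(2) False by auto
  qed
qed

text \<open>
  Walking backwards from the end of a chain path never leaves it: by injectivity the only
  preimage of a point is its predecessor on the path, and the first point has none.
\<close>

lemma reaches_last_in_chain_path:
  assumes "is_chain_path \<alpha> as" "inj_on \<alpha> (dom \<alpha>)" "(arrow \<alpha>)\<^sup>*\<^sup>* y (last as)"
  shows "y \<in> set as"
  using assms(3)
proof (induction rule: converse_rtranclp_induct)
  case base
  then show ?case using assms by (simp add: is_chain_path_def)
next
  case (step y z)
  then obtain i where i: "i < length as" "as ! i = z" by (auto simp: in_set_conv_nth)
  have "i \<noteq> 0"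
    using i step assms(1) by (metis arrow_def hd_conv_nth is_chain_path_def ranI)
  then obtain j where j: "i = Suc j" by (cases i) auto
  have "\<alpha> (as ! j) = Some z"
    using successively_nth[of "arrow \<alpha>" as j] assms(1) i j by (simp add: is_chain_path_def arrow_def)
  then have "as ! j = y"
    using assms(2) step(1) by (auto simp: inj_on_def arrow_def dom_def)
  then show ?case using i j by auto
qed

text \<open>
  Assigning to each point outside \<open>dom \<alpha>\<close> its component is a bijection onto the chains, with the
  last point of a chain path as inverse.
\<close>

lemma card_chain_components:
  assumes \<alpha>: "\<alpha> \<in> sym_inv_semigroup n"
  shows "card (chain_components n \<alpha>) = card ({1..n} - dom \<alpha>)"
proof -
  define R where "R = {(x, y). x \<in> {1..n} \<and> y \<in> {1..n} \<and> equivclp (arrow \<alpha>) x y}"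
  have inj: "inj_on \<alpha> (dom \<alpha>)" using \<alpha> by (simp add: sym_inv_semigroup_def)
  have same_end: "x = y" if "equivclp (arrow \<alpha>) x y" "\<alpha> x = None" "\<alpha> y = None" for x y
    using equivclp_chain_end[OF that(1,2)]
    by (cases rule: converse_rtranclpE) (use that in \<open>auto simp: arrow_def\<close>)
  have path_class: "set as = R `` {last as}"
    if as: "is_chain_path \<alpha> as" "set as \<subseteq> {1..n}" for as
  proof -
    have "last as \<in> set as" using as(1) by (simp add: is_chain_path_def)
    then have l: "last as \<in> {1..n}" using as(2) ..
    have end_undefined: "\<alpha> (last as) = None"
      using as(1) by (auto simp: is_chain_path_def)
    have "equivclp (arrow \<alpha>) (last as) y" if "y \<in> set as" for y
      using chain_path_reaches_last[of \<alpha> as y] as that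
      by (auto simp: is_chain_path_def intro: converse_rtranclp_into_equivclp)
    moreover have "y \<in> set as" if "equivclp (arrow \<alpha>) (last as) y" for y
      using reaches_last_in_chain_path[OF as(1) inj equivclp_chain_end[OF that end_undefined]] .
    ultimately show ?thesis using as l by (auto simp: R_def)
  qed
  have "bij_betw (\<lambda>x. R `` {x}) ({1..n} - dom \<alpha>) (chain_components n \<alpha>)"
    unfolding bij_betw_def
  proof
    show "inj_on (\<lambda>x. R `` {x}) ({1..n} - dom \<alpha>)"
    proof (rule inj_onI)
      fix x y assume *: "x \<in> {1..n} - dom \<alpha>" "y \<in> {1..n} - dom \<alpha>" "R `` {x} = R `` {y}"
      then have "y \<in> R `` {x}" by (auto simp: R_def)
      then show "x = y" using * by (intro same_end) (auto simp: R_def)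
    qed
    show "(\<lambda>x. R `` {x}) ` ({1..n} - dom \<alpha>) = chain_components n \<alpha>"
    proof (intro equalityI subsetI)
      fix C assume "C \<in> (\<lambda>x. R `` {x}) ` ({1..n} - dom \<alpha>)"
      then obtain x where "x \<in> {1..n} - dom \<alpha>" "C = R `` {x}" by blast
      then have x: "x \<in> {1..n}" "\<alpha> x = None" "C = R `` {x}" by auto
      obtain as where as: "is_chain_path \<alpha> as" "last as = x" "set as \<subseteq> {1..n}"
        using ex_chain_path[OF x(1,2) \<alpha>] .
      have "C \<in> graph_components n \<alpha>"
        unfolding graph_components_def R_def[symmetric] x(3) using x(1) by (rule quotientI)
      then show "C \<in> chain_components n \<alpha>"
        using path_class[OF as(1,3)] as x by (auto simp: chain_components_def)
    next
      fix C assume "C \<in> chain_components n \<alpha>"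
      then obtain as where as: "is_chain_path \<alpha> as" "set as = C" and C: "C \<in> graph_components n \<alpha>"
        by (auto simp: chain_components_def)
      have sub: "C \<subseteq> {1..n}" using C by (auto simp: graph_components_def quotient_def)
      have "last as \<in> C" "last as \<notin> dom \<alpha>"
        using as by (auto simp: is_chain_path_def)
      then have "last as \<in> {1..n} - dom \<alpha>"
        using sub by auto
      then show "C \<in> (\<lambda>x. R `` {x}) ` ({1..n} - dom \<alpha>)"
        using path_class[OF as(1)] as sub by auto
    qed
  qed
  then show ?thesis by (simp add: bij_betw_same_card)
qed

section \<open>Equality of the two totals\<close>

lemma sym_inv_semigroup_eq: "sym_inv_semigroup n = partial_injections {1..n} {1..n}"
  by (simp add: sym_inv_semigroup_def partial_injections_def)

lemma card_undefined_at:
  assumes "x \<in> {1..n}"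
  shows "card {\<alpha> \<in> sym_inv_semigroup n. x \<notin> dom \<alpha>} = num_partial_injections (n - 1) n"
proof -
  have "{\<alpha> \<in> sym_inv_semigroup n. x \<notin> dom \<alpha>} = partial_injections ({1..n} - {x}) {1..n}"
    by (auto simp: sym_inv_semigroup_def partial_injections_def)
  then show ?thesis using assms by (simp add: card_partial_injections)
qed

lemma sum_card_chain_components:
  "(\<Sum>\<alpha>\<in>sym_inv_semigroup n. card (chain_components n \<alpha>)) =
     n * num_partial_injections (n - 1) n"
proof -
  have "(\<Sum>\<alpha>\<in>sym_inv_semigroup n. card (chain_components n \<alpha>)) =
      (\<Sum>\<alpha>\<in>sym_inv_semigroup n. card {x \<in> {1..n}. x \<notin> dom \<alpha>})"
    by (intro sum.cong refl) (simp add: card_chain_components set_diff_eq)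
  also have "\<dots> = (\<Sum>x\<in>{1..n}. card {\<alpha> \<in> sym_inv_semigroup n. x \<notin> dom \<alpha>})"
    by (rule sum_multicount_gen) (auto simp: finite_sym_inv_semigroup)
  also have "\<dots> = n * num_partial_injections (n - 1) n"
    by (simp add: card_undefined_at)
  finally show ?thesis .
qed

lemma sum_card_partial_orbit:
  assumes "x \<in> {1..n}"
  shows "(\<Sum>\<alpha>\<in>sym_inv_semigroup n. card (partial_orbit \<alpha> x)) =
    n * num_partial_injections (n - 1) n"
proof -
  let ?S = "sym_inv_semigroup n" and ?r = "num_partial_injections (n - 1) n"
  have ins: "insert x ({1..n} - {x}) = {1..n}" using assms by auto
  have card: "card ({1..n} - {x}) = n - 1" "Suc (n - 1) = n" using assms by auto
  have "card (forward_orbit \<alpha> x \<inter> {1..n}) =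
      card (partial_orbit \<alpha> x) + (if x \<notin> dom \<alpha> then 1 else 0)" if "\<alpha> \<in> ?S" for \<alpha>
  proof -
    have "forward_orbit \<alpha> x \<inter> {1..n} = forward_orbit \<alpha> x"
      using forward_orbit_subset[of \<alpha> x] that assms by (auto simp: sym_inv_semigroup_def)
    moreover have "forward_orbit \<alpha> x = {x}" if "x \<notin> dom \<alpha>"
      using that by (intro forward_orbit_undefined) auto
    ultimately show ?thesis by (simp add: partial_orbit_eq)
  qed
  then have "(\<Sum>\<alpha>\<in>?S. card (forward_orbit \<alpha> x \<inter> {1..n})) =
      (\<Sum>\<alpha>\<in>?S. card (partial_orbit \<alpha> x)) + card {\<alpha> \<in> ?S. x \<notin> dom \<alpha>}"
    using finite_sym_inv_semigroup[of n]
    by (simp add: sum.distrib sum.If_cases Int_def)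
  \<comment> \<open>Initially start and extra target coincide: every point is both a source and a target.\<close>
  moreover have "(\<Sum>\<alpha>\<in>?S. card (forward_orbit \<alpha> x \<inter> {1..n})) = (n + 1) * ?r"
  proof -
    have "(\<Sum>\<alpha>\<in>?S. card (forward_orbit \<alpha> x \<inter> {1..n})) =
        (n - 1 + 2) * num_partial_injections (n - 1) (Suc (n - 1))"
      using sum_card_forward_orbit[of "{1..n} - {x}" x x]
      unfolding ins sym_inv_semigroup_eq card(1) by simp
    moreover have "n - 1 + 2 = n + 1" using card(2) by simp
    ultimately show ?thesis by (simp only: card(2))
  qed
  ultimately show ?thesis using card_undefined_at[OF assms] by simp
qed

theorem theorem3:
  fixes n :: nat
  assumes "n \<ge> 1"
  shows "(\<Sum>\<alpha>\<in>sym_inv_semigroup n. card (partial_orbit \<alpha> 1)) =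
         (\<Sum>\<alpha>\<in>sym_inv_semigroup n. card (chain_components n \<alpha>))"
  using sum_card_partial_orbit[of 1 n] sum_card_chain_components[of n] assms by simp

end
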